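(* Let $r\ge 2$, $n=2^r$, $\nu=2^{r-1}-1$. (1) If $\mathcal{C}$ is a zeroed NP1CC of length $n$ of Type B, or a zeroed NP1CC of length $n$ of Type C that contains a codeword of weight two, then $A_0(\mathcal{C})=1$ and for $1\le i\le n$, $$A_i(\mathcal{C})=\frac{\binom{n}{i}+(n-1)\Delta_i-\Delta_{i-1}}{n}.$$ (2) If $\mathcal{C}$ is a translate of an NP1CC of length $n$ of Type B, or a translate of an NP1CC of length $n$ of Type C, and $\mathcal{C}$ contains two codewords of weight one, then $A_0(\mathcal{C})=0$, $A_1(\mathcal{C})=2$, and for $i\ge 2$, $$A_i(\mathcal{C})=\frac{\binom{n}{i}+(n-1)\Delta_{i-1}-\Delta_i}{n}.$$
   Context: All codes are binary; $A_i(\mathcal{C})$ is the number of codewords of $\mathcal{C}$ of Hamming weight $i$. A code is zeroed if it contains the all-zero word. A translate of $\mathcal{C}$ is $\mathbf{x}+\mathcal{C}=\{\mathbf{x}+\mathbf{c}:\mathbf{c}\in\mathcal{C}\}$. An NP1CC of length $n=2^r$ is a code $\mathcal{C}\subseteq\mathbb{F}_2^n$ with $|\mathcal{C}|=2^{n-r}$ such that every word of $\mathbb{F}_2^n$ is at distance at most $1$ from some codeword. In an NP1CC every codeword $\mathbf{c}$ has exactly one other codeword $\mathbf{c}'$ (its partner) with $d(\mathbf{c},\mathbf{c}')\in\{1,2\}$. The NP1CC is of Type A if every partner is at distance $1$, Type B if every partner is at distance $2$, Type C otherwise. For integers $i\ge 0$: $\Delta_i=\binom{\nu}{\lfloor i/2\rfloor}$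 if $i\equiv 0,3\pmod 4$ and $\Delta_i=-\binom{\nu}{\lfloor i/2\rfloor}$ if $i\equiv 1,2\pmod 4$ (with $\binom{a}{b}=0$ for $b>a$). *)

theory Defs
  imports "HOL-Analysis.Finite_Cartesian_Product" "HOL-Library.Z2"
begin

text \<open>
  Words of length \<open>n\<close> over the binary field are elements of \<open>bit ^ 'n\<close> with \<open>CARD('n) = n\<close>;
  a code is an arbitrary (not necessarily linear) set of words.
\<close>

definition weight :: "bit ^ 'n::finite \<Rightarrow> nat" where
  "weight x = card {j. x $ j \<noteq> 0}"

definition hdist :: "bit ^ 'n::finite \<Rightarrow> bit ^ 'n \<Rightarrow> nat" where
  "hdist x y = card {j. x $ j \<noteq> y $ j}"

definition num_weight :: "(bit ^ 'n::finite) set \<Rightarrow> nat \<Rightarrow> nat" where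
  "num_weight C i = card {c \<in> C. weight c = i}"

definition zeroed :: "(bit ^ 'n::finite) set \<Rightarrow> bool" where
  "zeroed C \<longleftrightarrow> 0 \<in> C"

definition translate :: "bit ^ 'n::finite \<Rightarrow> (bit ^ 'n) set \<Rightarrow> (bit ^ 'n) set" where
  "translate x C = {x + c |c. c \<in> C}"

definition np1cc :: "nat \<Rightarrow> (bit ^ 'n::finite) set \<Rightarrow> bool" where
  "np1cc r C \<longleftrightarrow> CARD('n) = 2 ^ r \<and> card C = 2 ^ (CARD('n) - r) \<and>
     (\<forall>x. \<exists>c\<in>C. hdist x c \<le> 1)"

text \<open>
  In an NP1CC every codeword has exactly one partner, but this is a consequence of the definition
  above and not part of it; hence partnership is a relation here.
\<close>

definition partner :: "(bit ^ 'n::finite) set \<Rightarrow> bit ^ 'n \<Rightarrow> bit ^ 'n \<Rightarrow> bool" where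
  "partner C c c' \<longleftrightarrow> c \<in> C \<and> c' \<in> C \<and> hdist c c' \<in> {1, 2}"

definition type_A :: "nat \<Rightarrow> (bit ^ 'n::finite) set \<Rightarrow> bool" where
  "type_A r C \<longleftrightarrow> np1cc r C \<and> (\<forall>c c'. partner C c c' \<longrightarrow> hdist c c' = 1)"

definition type_B :: "nat \<Rightarrow> (bit ^ 'n::finite) set \<Rightarrow> bool" where
  "type_B r C \<longleftrightarrow> np1cc r C \<and> (\<forall>c c'. partner C c c' \<longrightarrow> hdist c c' = 2)"

definition type_C :: "nat \<Rightarrow> (bit ^ 'n::finite) set \<Rightarrow> bool" where
  "type_C r C \<longleftrightarrow> np1cc r C \<and> \<not> type_A r C \<and> \<not> type_B r C"

definition Delta :: "nat \<Rightarrow> nat \<Rightarrow> int" where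
  "Delta \<nu> i =
     (if i mod 4 \<in> {0, 3} then int (\<nu> choose (i div 2)) else - int (\<nu> choose (i div 2)))"

end

theory Submission imports Defs begin

text \<open>
  Let \<open>B\<close> be the operator summing a function over balls of radius one, \<open>f\<close> the indicator of the
  code and \<open>E = B f - 1 \<ge> 0\<close> the excess. Since \<open>n\<close> is even, \<open>B (B f)\<close> agrees with \<open>f\<close> modulo two,
  so \<open>B E\<close> is odd (hence positive) off the code and even on it. Double counting then forces
  \<open>E \<in> {0, 1}\<close>, \<open>B E = 1\<close> off the code, and \<open>B E\<close> to have average two on the code. A codeword with
  \<open>B E = 0\<close> is impossible: the local weight distribution around it would give \<open>6 A\<^sub>3 = n\<^sup>2\<close>, a power
  of two. Hence \<open>B E = 1 + f\<close>. Together with \<open>B f = 1 + E\<close> this is a recursion for the weight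
  distributions of \<open>f\<close> and \<open>E\<close>, whose solutions are combinations of \<open>\<Delta>\<^sub>i\<close> and \<open>\<Delta>\<^sub>i\<^sub>-\<^sub>1\<close>, the
  coefficients of \<open>(1 - z) (1 - z\<^sup>2)\<^sup>\<nu>\<close> and of \<open>z\<close> times this polynomial.
\<close>

lemma UNIV_bit: "(UNIV :: bit set) = {0, 1}"
  by (auto intro: bit.exhaust)

text \<open>This makes \<open>bit ^ 'n\<close> a finite type, so that sums over all words are
  genuine finite sums.\<close>

instance bit :: finite
  by standard (simp add: UNIV_bit)

lemma CARD_bit [simp]: "CARD(bit) = 2"
  by (simp add: UNIV_bit)


section \<open>Words and balls of radius one\<close>

definition unit_word :: "'n::finite \<Rightarrow> bit ^ 'n" where
  "unit_word j = (\<chi> i. of_bool (i = j))"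

text \<open>The identity plus the adjacency operator of the hypercube. Integer values allow the
  constant 1 to be subtracted when the excess is formed.\<close>

definition ball_sum :: "(bit ^ 'n::finite \<Rightarrow> int) \<Rightarrow> bit ^ 'n \<Rightarrow> int" where
  "ball_sum f x = f x + (\<Sum>j\<in>UNIV. f (x + unit_word j))"

definition layer_sum :: "(bit ^ 'n::finite \<Rightarrow> int) \<Rightarrow> nat \<Rightarrow> int" where
  "layer_sum f i = (\<Sum>x | weight x = i. f x)"

lemma bit_vec_add_self [simp]: "x + x = (0 :: bit ^ 'n::finite)"
proof -
  have "a + a = 0" for a :: bit
    by (cases a) simp_all
  then show ?thesis
    by (simp add: vec_eq_iff)
qed

lemma bit_vec_add_cancel [simp]: "x + y + y = (x :: bit ^ 'n::finite)"
  by (simp add: add.assoc)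

lemma bit_vec_add_cancel_left [simp]: "x + (x + y) = (y :: bit ^ 'n::finite)"
  by (simp flip: add.assoc)

lemma sum_shift:
  fixes f :: "bit ^ 'n::finite \<Rightarrow> 'b::comm_monoid_add"
  shows "(\<Sum>x\<in>UNIV. f (x + y)) = (\<Sum>x\<in>UNIV. f x)"
  by (rule sum.reindex_bij_witness[where i = "\<lambda>x. x + y" and j = "\<lambda>x. x + y"]) auto

lemma hdist_eq_weight: "hdist x y = weight (x + y)"
proof -
  have "x $ j \<noteq> y $ j \<longleftrightarrow> (x + y) $ j \<noteq> 0" for j
    by (cases "x $ j"; cases "y $ j") simp_all
  then show ?thesis
    unfolding hdist_def weight_def by presburger
qed

lemma weight_0 [simp]: "weight 0 = 0"
  by (simp add: weight_def)

lemma weight_eq_0_iff [simp]: "weight x = 0 \<longleftrightarrow> x = 0"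
  by (auto simp: weight_def vec_eq_iff)

lemma weight_eq_1_iff: "weight x = 1 \<longleftrightarrow> (\<exists>j. x = unit_word j)"
proof
  assume "weight x = 1"
  then obtain j where "{j. x $ j \<noteq> 0} = {j}"
    unfolding weight_def card_1_singleton_iff by (auto simp: card_Suc_eq)
  then have support: "x $ i \<noteq> 0 \<longleftrightarrow> i = j" for i
    by blast
  have "x $ i = of_bool (i = j)" for i
    using support[of i] by (cases "x $ i") simp_all
  then have "x = unit_word j"
    unfolding vec_eq_iff unit_word_def by simp
  then show "\<exists>j. x = unit_word j" ..
qed (auto simp: weight_def unit_word_def)

lemma weight_add_unit_word:
  "weight (x + unit_word j) = (if x $ j = 0 then weight x + 1 else weight x - 1)"
proof (cases "x $ j = 0")
  case True
  have "{i. (x + unit_word j) $ i \<noteq> 0} = insert j {i. x $ i \<noteq> 0}"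
    using True by (auto simp: unit_word_def)
  then show ?thesis
    using True unfolding weight_def by simp
next
  case False
  have "{i. (x + unit_word j) $ i \<noteq> 0} = {i. x $ i \<noteq> 0} - {j}"
    using False by (auto simp: unit_word_def)
  then show ?thesis
    using False unfolding weight_def by simp
qed

lemma weight_pos: "x $ j \<noteq> 0 \<Longrightarrow> weight x > 0"
  by (auto simp: weight_def card_gt_0_iff)

lemma card_zero_coords:
  fixes x :: "bit ^ 'n::finite"
  shows "int (card {j. x $ j = 0}) = int CARD('n) - int (weight x)"
proof -
  have "{j. x $ j = 0} \<union> {j. x $ j \<noteq> 0} = UNIV" and "{j. x $ j = 0} \<inter> {j. x $ j \<noteq> 0} = {}"
    by auto
  then have "card {j. x $ j = 0} + card {j. x $ j \<noteq> 0} = CARD('n)"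
    using card_Un_disjoint[of "{j. x $ j = 0}" "{j. x $ j \<noteq> 0}"] by simp
  then show ?thesis
    unfolding weight_def by linarith
qed

section \<open>The ball-sum operator: total mass, symmetry and parity\<close>

lemma sum_ball_sum:
  fixes f :: "bit ^ 'n::finite \<Rightarrow> int"
  shows "(\<Sum>x\<in>UNIV. ball_sum f x) = (int CARD('n) + 1) * (\<Sum>x\<in>UNIV. f x)"
proof -
  have "(\<Sum>x\<in>UNIV. ball_sum f x) =
      (\<Sum>x\<in>UNIV. f x) + (\<Sum>j\<in>(UNIV::'n set). \<Sum>x\<in>UNIV. f (x + unit_word j))"
    unfolding ball_sum_def sum.distrib by (subst sum.swap) (rule refl)
  also have "\<dots> = (int CARD('n) + 1) * (\<Sum>x\<in>UNIV. f x)"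
    unfolding sum_shift by (simp add: algebra_simps)
  finally show ?thesis .
qed

text \<open>The operator is self-adjoint because adding \<open>unit_word j\<close> is an involution
  on the words.\<close>

lemma sum_mult_ball_sum:
  fixes f g :: "bit ^ 'n::finite \<Rightarrow> int"
  shows "(\<Sum>x\<in>UNIV. f x * ball_sum g x) = (\<Sum>x\<in>UNIV. ball_sum f x * g x)"
proof -
  have "(\<Sum>x\<in>UNIV. f x * g (x + unit_word j)) = (\<Sum>x\<in>UNIV. f (x + unit_word j) * g x)" for j
    using sum_shift[of "\<lambda>x. f x * g (x + unit_word j)" "unit_word j"] by simp
  then have "(\<Sum>x\<in>UNIV. \<Sum>j\<in>UNIV. f x * g (x + unit_word j)) =
      (\<Sum>x\<in>UNIV. \<Sum>j\<in>UNIV. f (x + unit_word j) * g x)"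
    by (subst (1 2) sum.swap) simp
  then show ?thesis
    by (simp add: ball_sum_def algebra_simps sum.distrib sum_distrib_left)
qed

lemma ball_sum_diff_const:
  fixes f :: "bit ^ 'n::finite \<Rightarrow> int"
  shows "ball_sum (\<lambda>x. f x - c) x = ball_sum f x - (int CARD('n) + 1) * c"
  by (simp add: ball_sum_def sum_subtractf algebra_simps)

lemma ball_sum_shift: "ball_sum (\<lambda>x. f (x + y)) x = ball_sum f (x + y)"
  by (simp add: ball_sum_def add_ac)

text \<open>Off the diagonal, the terms for \<open>(i, j)\<close> and \<open>(j, i)\<close> are
  equal and pair up.\<close>

lemma even_double_sum:
  fixes h :: "'a \<Rightarrow> 'a \<Rightarrow> int"
  assumes "finite A" and "\<And>i j. h i j = h j i"
  shows "even ((\<Sum>i\<in>A. \<Sum>j\<in>A. h i j) - (\<Sum>i\<in>A. h i i))"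
  using assms(1)
proof induction
  case (insert a A)
  have "(\<Sum>i\<in>A. h i a) = (\<Sum>j\<in>A. h a j)"
    using assms(2) by (intro sum.cong) auto
  then have "(\<Sum>i\<in>insert a A. \<Sum>j\<in>insert a A. h i j) - (\<Sum>i\<in>insert a A. h i i)
      = 2 * (\<Sum>j\<in>A. h a j) + ((\<Sum>i\<in>A. \<Sum>j\<in>A. h i j) - (\<Sum>i\<in>A. h i i))"
    using insert.hyps by (simp add: sum.distrib)
  then show ?case
    using insert.IH by simp
qed simp

text \<open>Expanding twice, each neighbour of \<open>x\<close> is counted twice through the
  identity parts, and the symmetric double sum is congruent modulo 2 to its diagonal, which is
  \<open>CARD('n) * f x\<close> and hence even.\<close>

lemma even_ball_sum_ball_sum:
  fixes f :: "bit ^ 'n::finite \<Rightarrow> int"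
  assumes "even CARD('n)"
  shows "even (ball_sum (ball_sum f) x - f x)"
proof -
  define h where "h i j = f (x + unit_word i + unit_word j)" for i j
  have "h i j = h j i" for i j
    unfolding h_def by (simp add: add_ac)
  then have "even ((\<Sum>i\<in>UNIV. \<Sum>j\<in>UNIV. h i j) - (\<Sum>i\<in>UNIV. h i i))"
    by (intro even_double_sum) auto
  moreover have "(\<Sum>i\<in>UNIV. h i i) = int CARD('n) * f x"
    unfolding h_def by simp
  moreover have "ball_sum (ball_sum f) x - f x =
      2 * (\<Sum>i\<in>UNIV. f (x + unit_word i)) + (\<Sum>i\<in>UNIV. \<Sum>j\<in>UNIV. h i j)"
    by (simp add: ball_sum_def h_def sum.distrib)
  ultimately show ?thesis
    using assms by simp
qed


section \<open>Layer sums\<close>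

lemma layer_sum_0: "layer_sum f 0 = f 0"
  by (simp add: layer_sum_def)

lemma layer_sum_const_1: "layer_sum (\<lambda>x :: bit ^ 'n::finite. 1) i = int (CARD('n) choose i)"
proof -
  have "bij_betw (\<lambda>x :: bit ^ 'n. {j. x $ j \<noteq> 0}) {x. weight x = i} {S. S \<subseteq> UNIV \<and> card S = i}"
  proof (rule bij_betw_byWitness[where f' = "\<lambda>S. \<chi> j. of_bool (j \<in> S)"])
    show "\<forall>x\<in>{x. weight x = i}. (\<chi> j. of_bool (j \<in> {j. x $ j \<noteq> 0})) = (x :: bit ^ 'n)"
      by (auto simp: vec_eq_iff)
  qed (auto simp: weight_def)
  then show ?thesis
    using n_subsets[of "UNIV :: 'n set" i] by (simp add: layer_sum_def bij_betw_same_card)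
qed

lemma layer_sum_add: "layer_sum (\<lambda>x. f x + g x) i = layer_sum f i + layer_sum g i"
  by (simp add: layer_sum_def sum.distrib)

text \<open>Adjacent pairs are counted from the other end: \<open>y\<close> contributes
  \<open>f y\<close> once for each of its neighbours in layer \<open>i\<close>.\<close>

lemma layer_sum_shifts:
  fixes f :: "bit ^ 'n::finite \<Rightarrow> int"
  shows "layer_sum (\<lambda>x. \<Sum>j\<in>UNIV. f (x + unit_word j)) i =
    (\<Sum>y\<in>UNIV. f y * int (card {j. weight (y + unit_word j) = i}))"
proof -
  have "layer_sum (\<lambda>x. \<Sum>j\<in>UNIV. f (x + unit_word j)) i =
      (\<Sum>j\<in>UNIV. \<Sum>x\<in>UNIV. if weight x = i then f (x + unit_word j) else 0)"
    unfolding layer_sum_def by (subst sum.swap) (simp add: sum.If_cases)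
  also have "\<dots> = (\<Sum>j\<in>UNIV. \<Sum>y\<in>UNIV. if weight (y + unit_word j) = i then f y else 0)"
  proof (rule sum.cong)
    fix j :: 'n
    show "(\<Sum>x\<in>UNIV. if weight x = i then f (x + unit_word j) else 0) =
        (\<Sum>y\<in>UNIV. if weight (y + unit_word j) = i then f y else 0)"
      using sum_shift[of "\<lambda>y. if weight (y + unit_word j) = i then f y else 0" "unit_word j"]
      by simp
  qed simp
  also have "\<dots> = (\<Sum>y\<in>UNIV. f y * int (card {j. weight (y + unit_word j) = i}))"
    by (subst sum.swap) (simp add: sum.If_cases mult.commute)
  finally show ?thesis .
qed

lemma layer_sum_ball_sum_0:
  fixes f :: "bit ^ 'n::finite \<Rightarrow> int"
  shows "layer_sum (ball_sum f) 0 = layer_sum f 0 + layer_sum f 1"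
proof -
  have "inj (unit_word :: 'n \<Rightarrow> bit ^ 'n)"
    by (auto simp: inj_def unit_word_def vec_eq_iff)
  moreover have "{x :: bit ^ 'n. weight x = 1} = range unit_word"
    unfolding weight_eq_1_iff by auto
  ultimately have "layer_sum f 1 = (\<Sum>j\<in>UNIV. f (unit_word j))"
    by (simp add: layer_sum_def sum.reindex)
  then show ?thesis
    by (simp add: layer_sum_0 ball_sum_def)
qed

text \<open>A word of weight \<open>i\<close> has \<open>n - i\<close> neighbours in layer
  \<open>i + 1\<close>, a word of weight \<open>i + 2\<close> has \<open>i + 2\<close> of them, and
  no other weight is adjacent to that layer. For \<open>i > n\<close> the integer factor is
  negative, but the layer it multiplies is empty.\<close>

lemma layer_sum_ball_sum_Suc:
  fixes f :: "bit ^ 'n::finite \<Rightarrow> int"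
  shows "layer_sum (ball_sum f) (Suc i) = layer_sum f (Suc i)
    + (int CARD('n) - int i) * layer_sum f i + (int i + 2) * layer_sum f (i + 2)"
proof -
  have card_eq: "int (card {j. weight (y + unit_word j) = Suc i}) =
      (if weight y = i then int CARD('n) - int i else 0) + (if weight y = i + 2 then int i + 2 else 0)"
    for y :: "bit ^ 'n"
  proof -
    have "{j. weight (y + unit_word j) = Suc i} =
        (if weight y = i then {j. y $ j = 0} else if weight y = i + 2 then {j. y $ j \<noteq> 0} else {})"
      using weight_pos[of y] by (auto simp: weight_add_unit_word split: if_splits)
    then show ?thesis
      using card_zero_coords[of y] by (auto simp: weight_def)
  qed
  have "layer_sum (\<lambda>x. \<Sum>j\<in>UNIV. f (x + unit_word j)) (Suc i) =
      (\<Sum>y\<in>UNIV. (if weight y = i then (int CARD('n) - int i) * f y else 0)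
        + (if weight y = i + 2 then (int i + 2) * f y else 0))"
    unfolding layer_sum_shifts card_eq by (intro sum.cong) auto
  also have "\<dots> = (int CARD('n) - int i) * layer_sum f i + (int i + 2) * layer_sum f (i + 2)"
    by (simp add: layer_sum_def sum.distrib sum.If_cases sum_distrib_left)
  finally show ?thesis
    by (simp add: ball_sum_def[abs_def] layer_sum_add)
qed


section \<open>The excess of a code\<close>

definition excess :: "(bit ^ 'n::finite) set \<Rightarrow> bit ^ 'n \<Rightarrow> int" where
  "excess C x = ball_sum (\<lambda>y. of_bool (y \<in> C)) x - 1"

lemma ball_sum_indicator:
  "ball_sum (\<lambda>y. of_bool (y \<in> C)) = (\<lambda>x. 1 + excess C x)"
  by (simp add: excess_def fun_eq_iff)

lemma layer_sum_indicator: "layer_sum (\<lambda>x. of_bool (x \<in> C)) i = int (num_weight C i)"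
  by (simp add: layer_sum_def num_weight_def Int_def conj_commute)

lemma mem_translate: "x \<in> translate y C \<longleftrightarrow> x + y \<in> C"
proof
  assume "x + y \<in> C"
  then have "x = y + (x + y) \<and> x + y \<in> C"
    by (simp add: add_ac)
  then show "x \<in> translate y C"
    unfolding translate_def by blast
qed (auto simp: translate_def add_ac)

lemma excess_translate: "excess (translate y C) x = excess C (x + y)"
  unfolding excess_def mem_translate using ball_sum_shift[of "\<lambda>x. of_bool (x \<in> C)" y x] by simp

text \<open>Used to move an arbitrary codeword to the origin, and for the translates in the second
  half of the theorem.\<close>

lemma np1cc_translate:
  assumes "np1cc r C"
  shows "np1cc r (translate y C)"
proof -
  have "translate y C = (\<lambda>c. y + c) ` C"
    by (auto simp: translate_def)
  then have "card (translate y C) = card C"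
    by (simp add: card_image)
  moreover have "\<exists>c\<in>translate y C. hdist x c \<le> 1" for x
  proof -
    obtain c where "c \<in> C" "hdist (x + y) c \<le> 1"
      using assms unfolding np1cc_def by blast
    then have "c + y \<in> translate y C \<and> hdist x (c + y) \<le> 1"
      by (simp add: mem_translate hdist_eq_weight add_ac)
    then show ?thesis
      by blast
  qed
  ultimately show ?thesis
    using assms unfolding np1cc_def by simp
qed

section \<open>The excess of a fixed NP1CC: sign and parity\<close>

context
  fixes r :: nat and C :: "(bit ^ 'n::finite) set"
  assumes np1cc: "np1cc r C" and r_pos: "r \<ge> 1"
begin

lemma card_index_eq: "CARD('n) = 2 ^ r"
  using np1cc by (simp add: np1cc_def)

lemma even_length: "even CARD('n)"
  using card_index_eq r_pos by simp

lemma length_mult_card: "int CARD('n) * int (card C) = 2 ^ CARD('n)"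
proof -
  \<comment> \<open>Ensures that the natural-number subtraction in the exponent
    \<open>CARD('n) - r\<close> is not truncated.\<close>
  have "r \<le> 2 ^ r"
    by (simp add: less_imp_le)
  then have "(2::nat) ^ r * 2 ^ (CARD('n) - r) = 2 ^ CARD('n)"
    using card_index_eq by (simp flip: power_add)
  then show ?thesis
    using np1cc unfolding np1cc_def by (metis of_nat_mult of_nat_numeral of_nat_power)
qed

lemma excess_nonneg: "excess C x \<ge> 0"
proof -
  obtain c where c: "c \<in> C" "weight (x + c) \<le> 1"
    using np1cc unfolding np1cc_def hdist_eq_weight by blast
  define s :: int where "s = (\<Sum>j\<in>UNIV. of_bool (x + unit_word j \<in> C))"
  have "s \<ge> 0"
    unfolding s_def by (simp add: sum_nonneg)
  have "weight (x + c) = 0 \<or> weight (x + c) = 1"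
    using c(2) by linarith
  then consider "x + c = 0" | j where "x + c = unit_word j"
    unfolding weight_eq_0_iff weight_eq_1_iff by blast
  then have "of_bool (x \<in> C) + s \<ge> 1"
  proof cases
    case 1
    then have "x = c"
      using bit_vec_add_cancel[of x c] by simp
    then show ?thesis
      using c(1) \<open>s \<ge> 0\<close> by simp
  next
    case (2 j)
    then have "x + unit_word j = c"
      using bit_vec_add_cancel_left[of x c] by simp
    then have "of_bool (x + unit_word j \<in> C) = (1::int)"
      using c(1) by simp
    then have "s \<ge> 1"
      unfolding s_def
      using member_le_sum[of j UNIV "\<lambda>j. of_bool (x + unit_word j \<in> C) :: int"] by simp
    then show ?thesis
      by simp
  qed
  then show ?thesis
    by (simp add: excess_def ball_sum_def s_def)
qed

section \<open>Double counting with the excess\<close>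

lemma sum_indicator: "(\<Sum>x\<in>UNIV. of_bool (x \<in> C)) = int (card C)"
  by simp

text \<open>The operator multiplies totals by \<open>n + 1\<close>, so the total is
  \<open>(n + 1) * card C - 2 ^ n\<close>, where \<open>n * card C = 2 ^ n\<close>.\<close>

lemma sum_excess: "(\<Sum>x\<in>UNIV. excess C x) = int (card C)"
  unfolding excess_def sum_subtractf sum_ball_sum sum_indicator
  using length_mult_card by (simp add: algebra_simps)

text \<open>Modulo 2 the ball sum of the excess is the indicator of \<open>C\<close> minus
  \<open>n + 1\<close>, and \<open>n + 1\<close> is odd.\<close>

lemma even_ball_sum_excess_iff: "even (ball_sum (excess C) x) \<longleftrightarrow> x \<in> C"
proof -
  have "ball_sum (excess C) x =
      ball_sum (ball_sum (\<lambda>y. of_bool (y \<in> C))) x - (int CARD('n) + 1)"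
    using ball_sum_diff_const[of "ball_sum (\<lambda>y. of_bool (y \<in> C))" 1 x]
    by (simp add: excess_def[abs_def])
  then show ?thesis
    using even_ball_sum_ball_sum[of "\<lambda>y. of_bool (y \<in> C)" x] even_length by (cases "x \<in> C") auto
qed

lemma ball_sum_excess_nonneg: "ball_sum (excess C) x \<ge> 0"
  unfolding ball_sum_def by (intro add_nonneg_nonneg sum_nonneg excess_nonneg)

lemma ball_sum_excess_off_code_ge_1:
  assumes "x \<in> -C"
  shows "ball_sum (excess C) x - 1 \<ge> 0"
proof -
  have "odd (ball_sum (excess C) x)"
    using assms even_ball_sum_excess_iff by simp
  then have "ball_sum (excess C) x \<noteq> 0"
    by auto
  then show ?thesis
    using ball_sum_excess_nonneg[of x] by linarith
qed

text \<open>By self-adjointness the operator moves from the excess \<open>E\<close> to the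
  indicator, which it turns into \<open>1 + E\<close>; then
  \<open>(1 + E) * E = E * (E - 1) + 2 * E\<close>.\<close>

lemma sum_code_ball_sum_excess:
  "(\<Sum>x\<in>C. ball_sum (excess C) x) = (\<Sum>x\<in>UNIV. excess C x * (excess C x - 1)) + 2 * int (card C)"
proof -
  have "(\<Sum>x\<in>C. ball_sum (excess C) x) = (\<Sum>x\<in>UNIV. of_bool (x \<in> C) * ball_sum (excess C) x)"
    by (simp add: sum.If_cases of_bool_def if_distrib[of "\<lambda>a. a * _"] cong: if_cong)
  also have "\<dots> = (\<Sum>x\<in>UNIV. (1 + excess C x) * excess C x)"
    by (simp add: sum_mult_ball_sum ball_sum_indicator)
  also have "\<dots> = (\<Sum>x\<in>UNIV. excess C x * (excess C x - 1)) + 2 * (\<Sum>x\<in>UNIV. excess C x)"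
    by (simp add: algebra_simps sum.distrib sum_subtractf sum_distrib_left)
  finally show ?thesis
    by (simp add: sum_excess)
qed

text \<open>The total \<open>(n + 1) * card C\<close> of the ball sums is split into code and
  complement; the complement has \<open>(n - 1) * card C\<close> words, and all multiples of
  \<open>card C\<close> cancel. Both remaining sums have nonnegative terms, so every term will
  vanish.\<close>

lemma excess_double_count:
  "(\<Sum>x\<in>UNIV. excess C x * (excess C x - 1)) + (\<Sum>x\<in>-C. ball_sum (excess C) x - 1) = 0"
proof -
  have "(\<Sum>x\<in>UNIV. ball_sum (excess C) x) =
      (\<Sum>x\<in>C. ball_sum (excess C) x) + (\<Sum>x\<in>-C. ball_sum (excess C) x)"
    by (subst sum.union_disjoint[symmetric]) auto
  moreover have "(\<Sum>x\<in>UNIV. ball_sum (excess C) x) = (int CARD('n) + 1) * int (card C)"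
    by (simp add: sum_ball_sum sum_excess)
  moreover have "int (card (-C)) = 2 ^ CARD('n) - int (card C)"
  proof -
    have "card C + card (-C) = CARD(bit ^ 'n)"
      by (subst card_Un_disjoint[symmetric]) auto
    then show ?thesis
      by (simp flip: of_nat_add add: algebra_simps)
  qed
  ultimately show ?thesis
    using sum_code_ball_sum_excess length_mult_card by (simp add: sum_subtractf algebra_simps)
qed

lemma excess_mult_pred_nonneg: "excess C x * (excess C x - 1) \<ge> 0"
proof (cases "excess C x = 0")
  case False
  then have "excess C x \<ge> 1"
    using excess_nonneg[of x] by linarith
  then show ?thesis
    by (intro mult_nonneg_nonneg) simp_all
qed simp

lemma sum_excess_mult_pred: "(\<Sum>x\<in>UNIV. excess C x * (excess C x - 1)) = 0"
  and sum_off_code: "(\<Sum>x\<in>-C. ball_sum (excess C) x - 1) = 0"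
proof -
  have "(\<Sum>x\<in>UNIV. excess C x * (excess C x - 1)) \<ge> 0"
    by (intro sum_nonneg excess_mult_pred_nonneg)
  moreover have "(\<Sum>x\<in>-C. ball_sum (excess C) x - 1) \<ge> 0"
    by (intro sum_nonneg ball_sum_excess_off_code_ge_1)
  ultimately show "(\<Sum>x\<in>UNIV. excess C x * (excess C x - 1)) = 0"
    and "(\<Sum>x\<in>-C. ball_sum (excess C) x - 1) = 0"
    using excess_double_count by linarith+
qed

lemma excess_le_1: "excess C x \<le> 1"
proof -
  have "excess C x * (excess C x - 1) = 0"
    using sum_excess_mult_pred excess_mult_pred_nonneg
    by (simp add: sum_nonneg_eq_0_iff)
  then show ?thesis
    by auto
qed

lemma ball_sum_excess_off_code:
  assumes "x \<notin> C"
  shows "ball_sum (excess C) x = 1"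
proof -
  have "\<forall>x\<in>-C. ball_sum (excess C) x - 1 = 0"
    using sum_off_code by (simp only: sum_nonneg_eq_0_iff[OF finite ball_sum_excess_off_code_ge_1])
  then show ?thesis
    using assms by simp
qed

text \<open>Otherwise the excess vanishes on the whole ball around the origin, and this determines
  the code layers up to weight three, with a count that is not an integer.\<close>

lemma ball_sum_excess_0_nonzero:
  assumes "0 \<in> C"
  shows "ball_sum (excess C) 0 \<noteq> 0"
proof
  assume zero: "ball_sum (excess C) 0 = 0"
  define n where "n = int CARD('n)"
  define a where "a i = layer_sum (\<lambda>x. of_bool (x \<in> C)) i" for i
  define e where "e i = layer_sum (excess C) i" for i
  have layers: "layer_sum (\<lambda>x. 1 + excess C x) i = int (CARD('n) choose i) + e i" for i
    by (simp add: layer_sum_add layer_sum_const_1 e_def)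
  have "(\<Sum>j\<in>UNIV. excess C (0 + unit_word j)) \<ge> 0"
    by (intro sum_nonneg excess_nonneg)
  then have "e 0 = 0"
    using zero excess_nonneg[of 0] by (simp add: ball_sum_def e_def layer_sum_0)
  moreover have "layer_sum (ball_sum (excess C)) 0 = 0"
    using zero by (simp add: layer_sum_0)
  ultimately have "e 1 = 0"
    using layer_sum_ball_sum_0[of "excess C"] by (simp add: e_def)
  have "a 0 = 1"
    using assms by (simp add: a_def layer_sum_0)
  have "a 0 + a 1 = 1 + e 0"
    using layer_sum_ball_sum_0[of "\<lambda>x. of_bool (x \<in> C)"] layers[of 0]
    by (simp add: ball_sum_indicator a_def)
  then have "a 1 = 0"
    using \<open>a 0 = 1\<close> \<open>e 0 = 0\<close> by simp
  have "x \<notin> C" if "weight x = 1" for x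
  proof
    assume "x \<in> C"
    have "(\<Sum>y | weight y = 1. of_bool (y \<in> C)) = (0::int)"
      using \<open>a 1 = 0\<close> by (simp only: a_def layer_sum_def)
    then have "\<forall>y\<in>{y. weight y = 1}. of_bool (y \<in> C) = (0::int)"
      by (subst (asm) sum_nonneg_eq_0_iff) auto
    then show False
      using that \<open>x \<in> C\<close> by simp
  qed
  \<comment> \<open>No word of weight one is a codeword, so the ball sum of the excess equals 1 on
    all of layer 1.\<close>
  then have "layer_sum (ball_sum (excess C)) 1 = layer_sum (\<lambda>x :: bit ^ 'n. 1) 1"
    unfolding layer_sum_def by (intro sum.cong) (auto simp: ball_sum_excess_off_code)
  then have "2 * e 2 = n"
    using layer_sum_ball_sum_Suc[of "excess C" 0] \<open>e 0 = 0\<close> \<open>e 1 = 0\<close>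
    by (simp add: layer_sum_const_1 n_def e_def numeral_2_eq_2)
  \<comment> \<open>The origin alone already accounts for the \<open>n\<close> words of weight one,
    leaving no codeword of weight two.\<close>
  have "a 1 + n * a 0 + 2 * a 2 = n + e 1"
    using layer_sum_ball_sum_Suc[of "\<lambda>x. of_bool (x \<in> C)" 0] layers[of 1]
    by (simp add: ball_sum_indicator a_def n_def numeral_2_eq_2)
  then have "a 2 = 0"
    using \<open>a 1 = 0\<close> \<open>a 0 = 1\<close> \<open>e 1 = 0\<close> by simp
  \<comment> \<open>In layer 2 only \<open>3 * a 3\<close> survives on the left; on the right stand
    \<open>n * (n - 1) / 2\<close> and \<open>n / 2\<close>.\<close>
  have "a 2 + (n - 1) * a 1 + 3 * a 3 = int (CARD('n) choose 2) + e 2"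
    using layer_sum_ball_sum_Suc[of "\<lambda>x. of_bool (x \<in> C)" 1] layers[of 2]
    by (simp add: ball_sum_indicator a_def n_def numeral_2_eq_2 numeral_3_eq_3)
  moreover have "2 * int (CARD('n) choose 2) = n * (n - 1)"
  proof -
    have "2 * (CARD('n) choose 2) = CARD('n) * (CARD('n) - 1)"
      by (simp add: choose_two even_length)
    then show ?thesis
      unfolding n_def
      by (metis One_nat_def Suc_leI of_nat_1 of_nat_diff of_nat_mult of_nat_numeral
          zero_less_card_finite)
  qed
  ultimately have "6 * a 3 = n * n"
    using \<open>a 1 = 0\<close> \<open>a 2 = 0\<close> \<open>2 * e 2 = n\<close> by (simp add: algebra_simps)
  \<comment> \<open>Here \<open>n * n = 4 ^ r\<close> is congruent to 1 modulo 3.\<close>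
  then have "(6 * a 3) mod 3 = (4::int) ^ r mod 3"
    by (simp add: n_def card_index_eq flip: power_mult_distrib)
  moreover have "(4::int) ^ r mod 3 = 1"
    using power_mod[of "4::int" 3 r] by simp
  moreover have "(6 * a 3) mod 3 = 0"
    by presburger
  ultimately show False
    by simp
qed

end

lemma ball_sum_excess_nonzero:
  assumes "np1cc r C" and "r \<ge> 1" and "c \<in> C"
  shows "ball_sum (excess C) c \<noteq> 0"
proof -
  have "0 \<in> translate c C"
    using assms(3) by (simp add: mem_translate)
  moreover have "ball_sum (excess (translate c C)) 0 = ball_sum (excess C) c"
    using ball_sum_shift[of "excess C" c 0] by (simp add: excess_translate[abs_def])
  ultimately show ?thesis
    using ball_sum_excess_0_nonzero[OF np1cc_translate[OF assms(1)] assms(2), of c] by simp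
qed

text \<open>On the code the values are even, nonnegative and nonzero, hence at least 2, while their
  sum is exactly \<open>2 * card C\<close>.\<close>

lemma ball_sum_excess:
  assumes "np1cc r C" and "r \<ge> 1"
  shows "ball_sum (excess C) x = 1 + of_bool (x \<in> C)"
proof (cases "x \<in> C")
  case True
  have ge_2: "ball_sum (excess C) c - 2 \<ge> 0" if "c \<in> C" for c
  proof -
    have "even (ball_sum (excess C) c)"
      using that even_ball_sum_excess_iff[OF assms] by simp
    then show ?thesis
      using ball_sum_excess_nonneg[OF assms, of c] ball_sum_excess_nonzero[OF assms that]
      by presburger
  qed
  have "(\<Sum>c\<in>C. ball_sum (excess C) c - 2) = 0"
    using sum_code_ball_sum_excess[OF assms] sum_excess_mult_pred[OF assms]
    by (simp add: sum_subtractf)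
  then have "\<forall>c\<in>C. ball_sum (excess C) c - 2 = 0"
    by (simp only: sum_nonneg_eq_0_iff[OF finite ge_2])
  then show ?thesis
    using True by simp
qed (simp add: ball_sum_excess_off_code[OF assms])


section \<open>Solving the recursion\<close>

text \<open>The integer form avoids truncated subtraction; for \<open>m > k\<close> both binomials
  are zero.\<close>

lemma int_binomial_Suc:
  "(int m + 1) * int (k choose Suc m) = (int k - int m) * int (k choose m)"
proof (cases "m \<le> k")
  case True
  have "Suc m * (k choose Suc m) = (k - m) * (k choose m)"
    by (simp only: binomial_absorption binomial_absorb_comp)
  then have "int (Suc m) * int (k choose Suc m) = int (k - m) * int (k choose m)"
    by (metis of_nat_mult)
  then show ?thesis
    using True by (simp add: of_nat_diff algebra_simps)
qed (simp add: binomial_eq_0)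

section \<open>Recursions for \<open>Delta\<close> and its shift\<close>

lemma Delta_even: "Delta \<nu> (2 * m) = (if even m then 1 else - 1) * int (\<nu> choose m)"
proof -
  have "(2 * m) mod 4 \<in> {0, 3} \<longleftrightarrow> even m"
    by (auto; presburger)
  then show ?thesis
    by (simp add: Delta_def)
qed

lemma Delta_odd: "Delta \<nu> (Suc (2 * m)) = (if even m then - 1 else 1) * int (\<nu> choose m)"
proof -
  have "Suc (2 * m) mod 4 \<in> {0, 3} \<longleftrightarrow> odd m"
    by (auto; presburger)
  then show ?thesis
    by (simp add: Delta_def)
qed

text \<open>For \<open>F = (1 - z) (1 - z^2)^\<nu>\<close> this is the coefficient of
  \<open>z^(i+1)\<close> in \<open>(1 - z^2) F' + (1 + (2 \<nu> + 1) z) F = 0\<close>. The proof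
  treats the parities of \<open>i\<close> separately, each reducing to the ratio of consecutive
  binomials.\<close>

lemma Delta_recursion:
  "(int i + 2) * Delta \<nu> (i + 2) + Delta \<nu> (Suc i) + (2 * int \<nu> + 1 - int i) * Delta \<nu> i = 0"
proof (cases "even i")
  case True
  then obtain m where m: "i = 2 * m"
    by (rule evenE)
  then have "i + 2 = 2 * Suc m" and "Suc i = Suc (2 * m)"
    by simp_all
  then have D: "Delta \<nu> (i + 2) = (if even (Suc m) then 1 else - 1) * int (\<nu> choose Suc m)"
    "Delta \<nu> (Suc i) = (if even m then - 1 else 1) * int (\<nu> choose m)"
    "Delta \<nu> i = (if even m then 1 else - 1) * int (\<nu> choose m)"
    using m by (simp_all only: Delta_even Delta_odd)
  show ?thesis
    unfolding D using int_binomial_Suc[of m \<nu>] by (auto simp: m algebra_simps)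
next
  case False
  then obtain m where m: "i = Suc (2 * m)"
    by (auto elim: oddE)
  then have "Suc i = 2 * Suc m" and "i + 2 = Suc (2 * Suc m)"
    by simp_all
  then have D: "Delta \<nu> (i + 2) = (if even (Suc m) then - 1 else 1) * int (\<nu> choose Suc m)"
    "Delta \<nu> (Suc i) = (if even (Suc m) then 1 else - 1) * int (\<nu> choose Suc m)"
    "Delta \<nu> i = (if even m then - 1 else 1) * int (\<nu> choose m)"
    using m by (simp_all only: Delta_even Delta_odd)
  show ?thesis
    unfolding D using int_binomial_Suc[of m \<nu>] by (auto simp: m algebra_simps)
qed

text \<open>The coefficients of \<open>z F\<close>. The case \<open>i = 0\<close> is separate
  because truncated subtraction would give \<open>Delta \<nu> 0 = 1\<close> in place of 0.\<close>

definition Delta_shift :: "nat \<Rightarrow> nat \<Rightarrow> int" where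
  "Delta_shift \<nu> i = (if i = 0 then 0 else Delta \<nu> (i - 1))"

lemma Delta_0 [simp]: "Delta \<nu> 0 = 1" and Delta_1 [simp]: "Delta \<nu> (Suc 0) = - 1"
  using Delta_even[of \<nu> 0] Delta_odd[of \<nu> 0] by simp_all

lemma Delta_shift_recursion:
  "(int i + 1) * Delta \<nu> (Suc i) + Delta \<nu> i + (2 * int \<nu> + 2 - int i) * Delta_shift \<nu> i = 0"
proof (cases i)
  case (Suc k)
  then show ?thesis
    using Delta_recursion[of k \<nu>] by (simp add: Delta_shift_def algebra_simps)
qed (simp add: Delta_shift_def)

text \<open>Exchanging \<open>a\<close> with \<open>e\<close> and \<alpha> with \<beta> preserves
  the form of the system, so this one step serves both sequences.\<close>

lemma coupled_recursion_step:
  fixes a e :: "nat \<Rightarrow> int"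
  assumes n: "n = 2 * \<nu> + 2"
    and rec: "a (Suc i) + (int n - int i) * a i + (int i + 2) * a (i + 2) =
      int (n choose Suc i) + e (Suc i)"
    and a_i: "int n * a i = int (n choose i) + \<alpha> * Delta \<nu> i + \<beta> * Delta_shift \<nu> i"
    and a_Suc: "int n * a (Suc i) =
      int (n choose Suc i) + \<alpha> * Delta \<nu> (Suc i) + \<beta> * Delta_shift \<nu> (Suc i)"
    and e_Suc: "int n * e (Suc i) =
      int (n choose Suc i) + \<beta> * Delta \<nu> (Suc i) + \<alpha> * Delta_shift \<nu> (Suc i)"
  shows "int n * a (i + 2) =
    int (n choose (i + 2)) + \<alpha> * Delta \<nu> (i + 2) + \<beta> * Delta_shift \<nu> (i + 2)"
proof -
  have nu: "2 * int \<nu> + 1 = int n - 1" "2 * int \<nu> + 2 = int n"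
    by (simp_all add: n)
  have shift: "Delta_shift \<nu> (Suc i) = Delta \<nu> i" "Delta_shift \<nu> (i + 2) = Delta \<nu> (Suc i)"
    by (simp_all add: Delta_shift_def)
  have bin0: "(int i + 1) * int (n choose Suc i) = (int n - int i) * int (n choose i)"
    by (rule int_binomial_Suc)
  have bin1: "(int i + 2) * int (n choose (i + 2)) = (int n - int i - 1) * int (n choose Suc i)"
    using int_binomial_Suc[of "Suc i" n] by (simp add: algebra_simps)
  have D: "(int i + 2) * Delta \<nu> (i + 2) + Delta \<nu> (Suc i) + (int n - 1 - int i) * Delta \<nu> i = 0"
    using Delta_recursion[of i \<nu>] unfolding nu .
  have D': "(int i + 1) * Delta \<nu> (Suc i) + Delta \<nu> i + (int n - int i) * Delta_shift \<nu> i = 0"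
    using Delta_shift_recursion[of i \<nu>] unfolding nu .
  \<comment> \<open>The recursion yields \<open>a (i + 2)\<close> only with the factor
    \<open>i + 2\<close>; this factor is positive and is cancelled afterwards.\<close>
  have "(int i + 2) * (int n * a (i + 2)) =
      (int i + 2) * (int (n choose (i + 2)) + \<alpha> * Delta \<nu> (i + 2) + \<beta> * Delta_shift \<nu> (i + 2))"
    using rec a_i a_Suc e_Suc bin0 bin1 D D' unfolding shift by algebra
  then show ?thesis
    by simp
qed

text \<open>\<open>int (n choose i)\<close> is a particular solution for both scaled sequences; the
  coefficients \<alpha> and \<beta> of the homogeneous part are read off at index 0.\<close>

lemma coupled_recursion:
  fixes a e :: "nat \<Rightarrow> int"
  assumes n: "n = 2 * \<nu> + 2"
    and a_0: "a 0 + a 1 = 1 + e 0" and e_0: "e 0 + e 1 = 1 + a 0"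
    and a_rec: "\<And>i. a (Suc i) + (int n - int i) * a i + (int i + 2) * a (i + 2) =
      int (n choose Suc i) + e (Suc i)"
    and e_rec: "\<And>i. e (Suc i) + (int n - int i) * e i + (int i + 2) * e (i + 2) =
      int (n choose Suc i) + a (Suc i)"
  defines "\<alpha> \<equiv> int n * a 0 - 1" and "\<beta> \<equiv> int n * e 0 - 1"
  shows "int n * a i = int (n choose i) + \<alpha> * Delta \<nu> i + \<beta> * Delta_shift \<nu> i"
proof -
  define P where "P i \<longleftrightarrow>
      int n * a i = int (n choose i) + \<alpha> * Delta \<nu> i + \<beta> * Delta_shift \<nu> i \<and>
      int n * e i = int (n choose i) + \<beta> * Delta \<nu> i + \<alpha> * Delta_shift \<nu> i" for i
  \<comment> \<open>The recursion has order two, so two consecutive indices are carried through the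
    induction.\<close>
  have "P i \<and> P (Suc i)"
  proof (induction i)
    case 0
    have a_1: "a (Suc 0) = 1 + e 0 - a 0" and e_1: "e (Suc 0) = 1 + a 0 - e 0"
      using a_0 e_0 by simp_all
    show ?case
      unfolding P_def \<alpha>_def \<beta>_def a_1 e_1 by (simp add: Delta_shift_def algebra_simps)
  next
    case (Suc i)
    then show ?case
      unfolding P_def
      using coupled_recursion_step[where a = a and e = e, OF n a_rec]
        coupled_recursion_step[where a = e and e = a, OF n e_rec]
      by simp
  qed
  then show ?thesis
    unfolding P_def by blast
qed


section \<open>The weight distribution\<close>

lemma num_weight_0: "num_weight C 0 = of_bool (0 \<in> C)"
proof -
  have "{c \<in> C. weight c = 0} = (if 0 \<in> C then {0} else {})"
    by auto
  then show ?thesis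
    by (simp add: num_weight_def)
qed

lemma num_weight_ge_1:
  fixes C :: "(bit ^ 'n::finite) set"
  shows "c \<in> C \<Longrightarrow> num_weight C (weight c) \<ge> 1"
  unfolding num_weight_def by (simp add: Suc_le_eq card_gt_0_iff) blast

context
  fixes r :: nat and C :: "(bit ^ 'n::finite) set"
  assumes np1cc: "np1cc r C" and r_pos: "r \<ge> 1"
begin

text \<open>This and the next three facts are the layer forms of \<open>B f = 1 + E\<close> and
  \<open>B E = 1 + f\<close>, as \<open>coupled_recursion\<close> expects them.\<close>

lemma code_layers_0: "int (num_weight C 0) + int (num_weight C 1) = 1 + excess C 0"
  using layer_sum_ball_sum_0[of "\<lambda>x. of_bool (x \<in> C)"]
  by (simp add: ball_sum_indicator layer_sum_indicator layer_sum_0)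

lemma excess_layers_0: "excess C 0 + layer_sum (excess C) 1 = 1 + int (num_weight C 0)"
  using layer_sum_ball_sum_0[of "excess C"]
  by (simp add: ball_sum_excess[OF np1cc r_pos] layer_sum_0 num_weight_0)

lemma code_layers_Suc:
  "int (num_weight C (Suc i)) + (int CARD('n) - int i) * int (num_weight C i)
    + (int i + 2) * int (num_weight C (i + 2))
    = int (CARD('n) choose Suc i) + layer_sum (excess C) (Suc i)"
  using layer_sum_ball_sum_Suc[of "\<lambda>x. of_bool (x \<in> C)" i]
  by (simp only: ball_sum_indicator layer_sum_indicator layer_sum_add layer_sum_const_1)

lemma excess_layers_Suc:
  "layer_sum (excess C) (Suc i) + (int CARD('n) - int i) * layer_sum (excess C) i
    + (int i + 2) * layer_sum (excess C) (i + 2)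
    = int (CARD('n) choose Suc i) + int (num_weight C (Suc i))"
proof -
  have "ball_sum (excess C) = (\<lambda>x. 1 + of_bool (x \<in> C))"
    using ball_sum_excess[OF np1cc r_pos] by blast
  then show ?thesis
    using layer_sum_ball_sum_Suc[of "excess C" i]
    by (simp only: layer_sum_indicator layer_sum_add layer_sum_const_1)
qed

text \<open>The whole distribution depends only on \<open>num_weight C 0\<close> and
  \<open>excess C 0\<close>; the two halves of the theorem are the values (1, 0) and (0, 1).\<close>

lemma num_weight_formula:
  assumes "CARD('n) = 2 * \<nu> + 2"
  shows "int CARD('n) * int (num_weight C i) = int (CARD('n) choose i)
    + (int CARD('n) * int (num_weight C 0) - 1) * Delta \<nu> i
    + (int CARD('n) * excess C 0 - 1) * Delta_shift \<nu> i"
  using coupled_recursion[where a = "\<lambda>i. int (num_weight C i)" and e = "layer_sum (excess C)",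
      OF assms _ _ code_layers_Suc excess_layers_Suc, of i]
    code_layers_0 excess_layers_0
  by (simp add: layer_sum_0)

lemma num_weight_formula_real:
  assumes "CARD('n) = 2 * \<nu> + 2" and "i \<ge> 1"
  shows "real (num_weight C i) = (real (CARD('n) choose i)
    + (real CARD('n) * real (num_weight C 0) - 1) * of_int (Delta \<nu> i)
    + (real CARD('n) * of_int (excess C 0) - 1) * of_int (Delta \<nu> (i - 1))) / real CARD('n)"
proof -
  have "real_of_int (int CARD('n) * int (num_weight C i)) = real_of_int (int (CARD('n) choose i)
      + (int CARD('n) * int (num_weight C 0) - 1) * Delta \<nu> i
      + (int CARD('n) * excess C 0 - 1) * Delta \<nu> (i - 1))"
    using num_weight_formula[OF assms(1), of i] assms(2) by (simp add: Delta_shift_def)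
  then show ?thesis
    by (simp add: field_simps)
qed

text \<open>
  A codeword of weight one would be the partner of \<open>0\<close>, leaving no room for codewords of weight two.
\<close>

lemma excess_0_eq_0_if_weight_2:
  assumes "0 \<in> C" and "c \<in> C" and "weight c = 2"
  shows "excess C 0 = 0"
proof (rule ccontr)
  assume "excess C 0 \<noteq> 0"
  then have "excess C 0 = 1"
    using excess_nonneg[OF np1cc r_pos, of 0] excess_le_1[OF np1cc r_pos, of 0] by linarith
  moreover have "num_weight C 0 = 1"
    using assms(1) by (simp add: num_weight_0)
  \<comment> \<open>Layer 0 of the two systems gives one codeword of weight one and excess total 1
    in layer 1; then layer 1 reads \<open>1 + n + 2 * num_weight C 2 = n + 1\<close>.\<close>
  ultimately have "num_weight C 2 = 0"
    using code_layers_0 excess_layers_0 code_layers_Suc[of 0] by (simp add: numeral_2_eq_2)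
  then show False
    using num_weight_ge_1[OF assms(2)] assms(3) by simp
qed

end

text \<open>A codeword of weight one would be a partner of the origin at distance one, so the ball
  around the origin holds no second codeword.\<close>

lemma excess_0_eq_0_if_type_B:
  assumes "type_B r C" and "r \<ge> 1" and "0 \<in> C"
  shows "excess C 0 = 0"
proof -
  have np1cc: "np1cc r C"
    using assms(1) by (simp add: type_B_def)
  have "c \<notin> C" if "weight c = 1" for c
  proof
    assume "c \<in> C"
    then have "partner C 0 c"
      using assms(3) that by (simp add: partner_def hdist_eq_weight)
    then have "hdist 0 c = 2"
      using assms(1) unfolding type_B_def by blast
    then show False
      using that by (simp add: hdist_eq_weight)
  qed
  then have "num_weight C 1 = 0"
    unfolding num_weight_def by (auto intro: card_eq_0_iff[THEN iffD2])
  then show ?thesis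
    using code_layers_0[OF np1cc assms(2)] assms(3) by (simp add: num_weight_0)
qed

theorem theorem5:
  fixes r n \<nu> :: nat
  assumes "r \<ge> 2" and "n = 2 ^ r" and "\<nu> = 2 ^ (r - 1) - 1" and "CARD('n::finite) = n"
  shows
    "(\<forall>C :: (bit ^ 'n) set.
        zeroed C \<and> (type_B r C \<or> type_C r C \<and> (\<exists>c\<in>C. weight c = 2)) \<longrightarrow>
          num_weight C 0 = 1 \<and>
          (\<forall>i. 1 \<le> i \<and> i \<le> n \<longrightarrow>
             real (num_weight C i) =
               (real (n choose i) + (real n - 1) * of_int (Delta \<nu> i) - of_int (Delta \<nu> (i - 1)))
                 / real n)) \<and>
     (\<forall>C :: (bit ^ 'n) set.
        (\<exists>x D. (type_B r D \<or> type_C r D) \<and> C = translate x D) \<and>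
        (\<exists>c\<in>C. \<exists>c'\<in>C. c \<noteq> c' \<and> weight c = 1 \<and> weight c' = 1) \<longrightarrow>
          num_weight C 0 = 0 \<and> num_weight C 1 = 2 \<and>
          (\<forall>i\<ge>2.
             real (num_weight C i) =
               (real (n choose i) + (real n - 1) * of_int (Delta \<nu> (i - 1)) - of_int (Delta \<nu> i))
                 / real n))"
proof -
  have r_pos: "r \<ge> 1"
    using assms(1) by simp
  have "(2::nat) ^ r = 2 * 2 ^ (r - 1)"
    using r_pos by (simp flip: power_Suc)
  moreover have "(2::nat) ^ (r - 1) \<ge> 1"
    by simp
  ultimately have n_eq: "n = 2 * \<nu> + 2"
    unfolding assms(2,3) by linarith
  note formula = num_weight_formula_real[where 'n = 'n, OF _ r_pos, unfolded assms(4), OF _ n_eq]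
  show ?thesis
  proof (rule conjI; intro allI impI)
    fix C :: "(bit ^ 'n) set"
    assume C: "zeroed C \<and> (type_B r C \<or> type_C r C \<and> (\<exists>c\<in>C. weight c = 2))"
    have np1cc: "np1cc r C"
      using C by (auto simp: type_B_def type_C_def)
    have "0 \<in> C"
      using C by (simp add: zeroed_def)
    then have "num_weight C 0 = 1" and "excess C 0 = 0"
      using C excess_0_eq_0_if_type_B[OF _ r_pos] excess_0_eq_0_if_weight_2[OF np1cc r_pos]
      by (auto simp: num_weight_0)
    then show "num_weight C 0 = 1 \<and> (\<forall>i. 1 \<le> i \<and> i \<le> n \<longrightarrow> real (num_weight C i) =
        (real (n choose i) + (real n - 1) * of_int (Delta \<nu> i) - of_int (Delta \<nu> (i - 1)))
          / real n)"
      using formula[OF np1cc] by simp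
  next
    fix C :: "(bit ^ 'n) set"
    assume "(\<exists>x D. (type_B r D \<or> type_C r D) \<and> C = translate x D) \<and>
      (\<exists>c\<in>C. \<exists>c'\<in>C. c \<noteq> c' \<and> weight c = 1 \<and> weight c' = 1)"
    then obtain x D c c' where D: "type_B r D \<or> type_C r D" "C = translate x D"
      and c: "c \<in> C" "c' \<in> C" "c \<noteq> c'" "weight c = 1" "weight c' = 1"
      by (elim conjE exE bexE)
    have np1cc: "np1cc r C"
      using D by (auto simp: type_B_def type_C_def intro: np1cc_translate)
    have "card {c, c'} \<le> num_weight C 1"
      unfolding num_weight_def using c by (intro card_mono) auto
    then have "num_weight C 1 \<ge> 2"
      using c(3) by simp
    \<comment> \<open>The ball around the origin contains \<open>1 + excess C 0 \<le> 2\<close>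
      codewords, and the two of weight one exhaust it.\<close>
    then have "num_weight C 0 = 0" and "num_weight C 1 = 2" and "excess C 0 = 1"
      using code_layers_0[OF np1cc r_pos] excess_le_1[OF np1cc r_pos, of 0] by linarith+
    then show "num_weight C 0 = 0 \<and> num_weight C 1 = 2 \<and> (\<forall>i\<ge>2. real (num_weight C i) =
        (real (n choose i) + (real n - 1) * of_int (Delta \<nu> (i - 1)) - of_int (Delta \<nu> i))
          / real n)"
      using formula[OF np1cc] by simp
  qed
qed

end
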